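(* Let $(X,d,\mu)$ be a space of homogeneous type, with constants $K\geq1$ and $\alpha,\beta>1$ such that $d(x,z)\leq K(d(x,y)+d(y,z))$ for all $x,y,z\in X$ and $\mu(\alpha B)\leq\beta\mu(B)$ for every open ball $B$. Let $\mathrm{ball}$ denote the family $\mathfrak{Q}=\{\mathcal{Q}_x\}_{x\in X}$ where, for every $x\in X$, $\mathcal{Q}_x$ is the set of all open balls of $X$ with center $x$ (respectively, the set of all open balls of $X$ containing $x$). Let $m$ be the smallest natural number with $\alpha^m\geq2K(4K^2+1)$. Then $$\mathscr{H}^{\mathrm{ball}}_\mu\leq\beta^m.$$ In particular, for every function $f:X\to\mathbb{C}$ in $\mathbf{L}^1(\mu)$, if $\mathbf{M}^{\mathrm{ball}}_\mu f$ denotes the centered-ball maximal function (respectively, ball maximal function) of $f$ with respect to $\mu$, given by $$\mathbf{M}^{\mathrm{ball}}_\mu f(x):=\sup_{Q\in\mathcal{Q}_x}\frac{1}{\mu(Q)}\int_Q|f|\,\mathrm{d}\mu\qquad(x\in X),$$ then for every $r>0$ $$\mu\{x:\mathbf{M}^{\mathrm{ball}}_\mu f(x)>r\}\leq r^{-1}\beta^m\|f\|_{\mathbf{L}^1(\mu)}.$$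
   Context: A quasimetric space is a set $X$ with a function $d:X\times X\to[0,\infty)$ such that $d(x,y)=0$ iff $x=y$, $d(x,y)=d(y,x)$, and $d(x,z)\leq K(d(x,y)+d(y,z))$ for some finite constant $K\geq1$. Its canonical topology is the one whose base is given by the open balls of $d$. A quasimetric space $X$ with a Borel measure $\mu$ is of homogeneous type if there exist finite constants $\alpha,\beta>1$ such that for every open ball $B$ we have $0<\mu(B)<\infty$ and $\mu(\alpha B)\leq\beta\mu(B)$, where $\alpha B$ is the ball with the same center as $B$ and radius $\alpha$ times the radius of $B$. The outer measure on $X$ canonically induced by the Borel measure $\mu$ is denoted by the same symbol $\mu$. Let $\mathfrak{Q}=\{\mathcal{Q}_x\}_{x\in X}$, where each $\mathcal{Q}_x$ is a nonempty set of subsets of $X$ containing $x$, let $\mathcal{Q}:=\bigcup_x\mathcal{Q}_x$, and let $\mu$ be an outer measure on $X$ with $0<\mu(Q)<\infty$ for every $Q\in\mathcal{Q}$. For a set function $F:\mathcal{Q}\to[0,\infty]$ define $\mathbf{M}^{\mathfrak{Q}}_\mu F(x):=\sup_{Q\in\mathcal{Q}_x}\frac{F(Q)}{\mu(Q)}$ and $\|F\|_{\mathcal{Q}}:=\sup\{\sum_{i=1}^nF(Q_i):Q_1,\ldots,Q_n\in\mathcal{Q},\ Q_i\cap Q_j=\emptyset\text{ for }i\neq j\}$. The Hardy-Littlewood maximal constant $\mathscr{H}^{\mathfrak{Q}}_\mu$ is the smallest constant $c$ (the infimum of all finite $c>0$) such that $\mu\{x\in X:\mathbf{M}^{\mathfrak{Q}}_\mu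 F(x)>r\}\leq c\,r^{-1}\|F\|_{\mathcal{Q}}$ for every $r>0$ and every $F:\mathcal{Q}\to[0,\infty]$; it is $\infty$ if no such finite $c$ exists. *)

theory Defs
  imports "HOL-Analysis.Analysis"
begin

locale quasimetric_space =
  fixes X :: "'a set" and d :: "'a \<Rightarrow> 'a \<Rightarrow> real" and K :: real
  assumes const_ge_1: "K \<ge> 1"
    and dist_nonneg: "\<And>x y. x \<in> X \<Longrightarrow> y \<in> X \<Longrightarrow> d x y \<ge> 0"
    and dist_zero_iff: "\<And>x y. x \<in> X \<Longrightarrow> y \<in> X \<Longrightarrow> d x y = 0 \<longleftrightarrow> x = y"
    and dist_sym: "\<And>x y. x \<in> X \<Longrightarrow> y \<in> X \<Longrightarrow> d x y = d y x"
    and quasi_triangle: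
      "\<And>x y z. x \<in> X \<Longrightarrow> y \<in> X \<Longrightarrow> z \<in> X \<Longrightarrow> d x z \<le> K * (d x y + d y z)"

definition open_ball :: "'a set \<Rightarrow> ('a \<Rightarrow> 'a \<Rightarrow> real) \<Rightarrow> 'a \<Rightarrow> real \<Rightarrow> 'a set" where
  "open_ball X d x r = {y \<in> X. d x y < r}"

(* In a quasimetric space the intersection of two open balls need not be a union of open balls.
   The generated topology is the one having the open balls as a base whenever such a topology
   exists; in all cases it is the coarsest one in which the open balls are open. *)
definition canonical_topology :: "'a set \<Rightarrow> ('a \<Rightarrow> 'a \<Rightarrow> real) \<Rightarrow> 'a topology" where
  "canonical_topology X d = topology_generated_by {open_ball X d x r |x r. x \<in> X \<and> r > 0}"

locale homogeneous_type = quasimetric_space X d K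
  for X :: "'a set" and d :: "'a \<Rightarrow> 'a \<Rightarrow> real" and K :: real +
  fixes M :: "'a measure" and \<alpha> \<beta> :: real
  assumes space_eq: "space M = X"
    and sets_eq_borel: "sets M = sigma_sets X {U. openin (canonical_topology X d) U}"
    and alpha_gt_1: "\<alpha> > 1"
    and beta_gt_1: "\<beta> > 1"
    and ball_pos: "\<And>x r. x \<in> X \<Longrightarrow> r > 0 \<Longrightarrow> 0 < emeasure M (open_ball X d x r)"
    and ball_finite: "\<And>x r. x \<in> X \<Longrightarrow> r > 0 \<Longrightarrow> emeasure M (open_ball X d x r) < \<infinity>"
    and doubling: "\<And>x r. x \<in> X \<Longrightarrow> r > 0 \<Longrightarrow>
      emeasure M (open_ball X d x (\<alpha> * r)) \<le> ennreal \<beta> * emeasure M (open_ball X d x r)"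

definition centered_balls :: "'a set \<Rightarrow> ('a \<Rightarrow> 'a \<Rightarrow> real) \<Rightarrow> 'a \<Rightarrow> 'a set set" where
  "centered_balls X d x = {open_ball X d x r |r. r > 0}"

definition containing_balls :: "'a set \<Rightarrow> ('a \<Rightarrow> 'a \<Rightarrow> real) \<Rightarrow> 'a \<Rightarrow> 'a set set" where
  "containing_balls X d x =
     {open_ball X d y r |y r. y \<in> X \<and> r > 0 \<and> x \<in> open_ball X d y r}"

(* Set functions are total on 'a set; only their values on members of the family are used. *)
definition set_maximal_function ::
    "('a set \<Rightarrow> ennreal) \<Rightarrow> ('a \<Rightarrow> 'a set set) \<Rightarrow> ('a set \<Rightarrow> ennreal) \<Rightarrow> 'a \<Rightarrow> ennreal" where
  "set_maximal_function \<mu> \<Q> F x = (SUP Q \<in> \<Q> x. F Q / \<mu> Q)"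

definition set_function_norm :: "'a set set \<Rightarrow> ('a set \<Rightarrow> ennreal) \<Rightarrow> ennreal" where
  "set_function_norm \<A> F =
     Sup {\<Sum>i<n. F (Q i) |(n::nat) Q. (\<forall>i<n. Q i \<in> \<A>) \<and> disjoint_family_on Q {..<n}}"

definition HL_maximal_constant ::
    "'a set \<Rightarrow> ('a set \<Rightarrow> ennreal) \<Rightarrow> ('a \<Rightarrow> 'a set set) \<Rightarrow> ennreal" where
  "HL_maximal_constant X \<mu> \<Q> =
     Inf {ennreal c |c::real. c > 0 \<and>
       (\<forall>r::real. r > 0 \<longrightarrow> (\<forall>F :: 'a set \<Rightarrow> ennreal.
          \<mu> {x \<in> X. set_maximal_function \<mu> \<Q> F x > ennreal r}
            \<le> ennreal (c * inverse r) * set_function_norm (\<Union>x\<in>X. \<Q> x) F))}"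

definition maximal_function ::
    "'a measure \<Rightarrow> ('a \<Rightarrow> 'a set set) \<Rightarrow> ('a \<Rightarrow> complex) \<Rightarrow> 'a \<Rightarrow> ennreal" where
  "maximal_function M \<Q> f x =
     (SUP Q \<in> \<Q> x. (\<integral>\<^sup>+ y \<in> Q. ennreal (norm (f y)) \<partial>M) / emeasure M Q)"

end

theory Submission
  imports Defs
begin

text \<open>
  Choose for every point of \<open>{M F > r}\<close> a ball \<open>B\<close> with \<open>F B > r \<mu> B\<close>. It suffices to
  bound the outer measure of the part lying in a fixed ball \<open>B\<^sub>0\<close>, since outer measures induced by
  measures are continuous along increasing sequences of arbitrary sets. If the radii of the chosen
  balls that meet \<open>B\<^sub>0\<close> are bounded, Vitali's covering argument yields a disjoint (hence, by
  finiteness of \<open>\<parallel>F\<parallel>\<close>, countable) subfamily whose \<open>\<alpha>\<^sup>m\<close>-dilates cover. If they are unbounded,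
  every ball \<open>B\<close> around the centre of \<open>B\<^sub>0\<close> lies in the \<open>\<alpha>\<^sup>m\<close>-dilate of a single chosen ball, so
  already \<open>\<mu> X \<le> \<beta>\<^sup>m r\<^sup>-\<^sup>1 \<parallel>F\<parallel>\<close>.
\<close>

section \<open>Vitali selection for abstract sets with sizes\<close>

text \<open>Zorn's lemma is applied to those disjoint subfamilies \<open>G\<close> for which every
  set that meets \<open>G\<close> at all meets a member of at least half its size. A maximal one
  meets every set: otherwise, a set of nearly maximal size among those missing \<open>G\<close>
  could be added. No geometry enters here, so the argument serves balls indexed by centre and
  radius.\<close>

lemma Vitali_disjoint_subfamily:
  fixes B :: "'i \<Rightarrow> 'a set" and \<rho> :: "'i \<Rightarrow> real"
  assumes pos: "\<And>p. p \<in> P \<Longrightarrow> \<rho> p > 0" and ne: "\<And>p. p \<in> P \<Longrightarrow> B p \<noteq> {}"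
    and bdd: "bdd_above (\<rho> ` P)"
  obtains G where "G \<subseteq> P" "disjoint_family_on B G"
    "\<And>p. p \<in> P \<Longrightarrow> \<exists>q\<in>G. B p \<inter> B q \<noteq> {} \<and> \<rho> p \<le> 2 * \<rho> q"
proof -
  define \<A> where "\<A> = {G. G \<subseteq> P \<and> disjoint_family_on B G \<and>
    (\<forall>p\<in>P. (\<exists>q\<in>G. B p \<inter> B q \<noteq> {}) \<longrightarrow> (\<exists>q\<in>G. B p \<inter> B q \<noteq> {} \<and> \<rho> p \<le> 2 * \<rho> q))}"
  have "\<exists>G\<in>\<A>. \<forall>H\<in>\<A>. G \<subseteq> H \<longrightarrow> H = G"
  proof (rule subset_Zorn')
    fix \<C> assume C: "subset.chain \<A> \<C>"
    then have sub: "\<C> \<subseteq> \<A>"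
      by (simp add: subset_chain_def)
    have "disjoint_family_on B (\<Union>\<C>)"
      unfolding disjoint_family_on_def
    proof (intro ballI impI)
      fix p q assume "p \<in> \<Union>\<C>" "q \<in> \<Union>\<C>" "p \<noteq> q"
      then obtain G H where "G \<in> \<C>" "H \<in> \<C>" "p \<in> G" "q \<in> H"
        by blast
      with C obtain D where "D \<in> \<C>" "p \<in> D" "q \<in> D"
        unfolding subset_chain_def by blast
      with sub \<open>p \<noteq> q\<close> show "B p \<inter> B q = {}"
        unfolding \<A>_def disjoint_family_on_def by blast
    qed
    \<comment> \<open>A set that meets the union of the chain meets one member of the chain, and the
      selection property of that member supplies the witness.\<close>
    moreover have "\<exists>q\<in>\<Union>\<C>. B p \<inter> B q \<noteq> {} \<and> \<rho> p \<le> 2 * \<rho> q"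
      if p: "p \<in> P" and meets: "\<exists>q\<in>\<Union>\<C>. B p \<inter> B q \<noteq> {}" for p
    proof -
      obtain G where "G \<in> \<C>" "\<exists>q\<in>G. B p \<inter> B q \<noteq> {}"
        using meets by blast
      moreover from this sub have "G \<in> \<A>"
        by blast
      ultimately have "\<exists>q\<in>G. B p \<inter> B q \<noteq> {} \<and> \<rho> p \<le> 2 * \<rho> q"
        using p unfolding \<A>_def by blast
      with \<open>G \<in> \<C>\<close> show ?thesis
        by blast
    qed
    moreover have "\<Union>\<C> \<subseteq> P"
      using sub unfolding \<A>_def by blast
    ultimately show "\<Union>\<C> \<in> \<A>"
      unfolding \<A>_def by blast
  qed
  then obtain G where G: "G \<in> \<A>" and max: "\<And>H. H \<in> \<A> \<Longrightarrow> G \<subseteq> H \<Longrightarrow> H = G"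
    by blast
  have GP: "G \<subseteq> P" and disj: "disjoint_family_on B G"
    and sel: "\<And>p. p \<in> P \<Longrightarrow> \<exists>q\<in>G. B p \<inter> B q \<noteq> {} \<Longrightarrow> \<exists>q\<in>G. B p \<inter> B q \<noteq> {} \<and> \<rho> p \<le> 2 * \<rho> q"
    using G unfolding \<A>_def by blast+
  define P' where "P' = {p\<in>P. \<forall>q\<in>G. B p \<inter> B q = {}}"
  have "P' = {}"
  proof (rule ccontr)
    assume "P' \<noteq> {}"
    have bdd': "bdd_above (\<rho> ` P')"
      using bdd by (rule bdd_above_mono) (auto simp: P'_def)
    define S where "S = (SUP p\<in>P'. \<rho> p)"
    obtain p1 where p1: "p1 \<in> P'"
      using \<open>P' \<noteq> {}\<close> by blast
    then have "0 < \<rho> p1" "\<rho> p1 \<le> S"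
      using pos bdd' by (auto simp: P'_def S_def intro: cSUP_upper)
    \<comment> \<open>Positive sizes give \<open>S > 0\<close>, so \<open>S / 2\<close> lies
      strictly below the supremum and is exceeded by some \<open>p0\<close>.\<close>
    then have "S / 2 < (SUP p\<in>P'. \<rho> p)"
      unfolding S_def[symmetric] by simp
    then obtain p0 where p0: "p0 \<in> P'" "S / 2 < \<rho> p0"
      using less_cSUP_iff[OF \<open>P' \<noteq> {}\<close> bdd'] by blast
    have p0G: "\<forall>q\<in>G. B p0 \<inter> B q = {}" and "p0 \<in> P"
      using p0(1) by (auto simp: P'_def)
    then have "p0 \<notin> G"
      using ne by blast
    have "disjoint_family_on B (insert p0 G)"
      using disj p0G unfolding disjoint_family_on_def by blast
    moreover have "\<exists>q\<in>insert p0 G. B p \<inter> B q \<noteq> {} \<and> \<rho> p \<le> 2 * \<rho> q"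
      if p: "p \<in> P" and meets: "\<exists>q\<in>insert p0 G. B p \<inter> B q \<noteq> {}" for p
    \<comment> \<open>An index in \<open>P'\<close> can meet only the new set, whose size is more
      than \<open>S / 2\<close>; any other index already has a witness in the old
      \<open>G\<close>.\<close>
    proof (cases "p \<in> P'")
      case True
      then have "\<rho> p \<le> S"
        using bdd' by (auto simp: S_def intro: cSUP_upper)
      with p0(2) have "\<rho> p \<le> 2 * \<rho> p0"
        by simp
      moreover have "B p \<inter> B p0 \<noteq> {}"
        using True meets unfolding P'_def by blast
      ultimately show ?thesis
        by blast
    next
      case False
      with p have "\<exists>q\<in>G. B p \<inter> B q \<noteq> {}"
        unfolding P'_def by blast
      from sel[OF p this] show ?thesis
        by blast
    qed
    ultimately have "insert p0 G \<in> \<A>"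
      using GP \<open>p0 \<in> P\<close> unfolding \<A>_def by blast
    from max[OF this] \<open>p0 \<notin> G\<close> show False
      by blast
  qed
  then have "\<exists>q\<in>G. B p \<inter> B q \<noteq> {} \<and> \<rho> p \<le> 2 * \<rho> q" if "p \<in> P" for p
    using sel that unfolding P'_def by blast
  with GP disj show thesis
    by (rule that)
qed

section \<open>Bounds on finite sums and countable families\<close>

text \<open>Subadditivity bounds finite unions, and continuity from below passes to the whole union.
  The hypothesis on finite sums has the shape in which \<open>set_function_norm\<close> provides
  bounds.\<close>

lemma emeasure_countable_UN_le:
  assumes "countable I" and meas: "\<And>i. i \<in> I \<Longrightarrow> A i \<in> sets M"
    and le: "\<And>J. finite J \<Longrightarrow> J \<subseteq> I \<Longrightarrow> (\<Sum>j\<in>J. emeasure M (A j)) \<le> C"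
  shows "emeasure M (\<Union>i\<in>I. A i) \<le> C"
proof (cases "I = {}")
  case False
  \<comment> \<open>For finite \<open>I\<close> the enumeration repeats elements; taking its image
    makes every index count only once in a sum over \<open>J n\<close>.\<close>
  define J where "J n = from_nat_into I ` {..<n::nat}" for n
  have J: "finite (J n)" "J n \<subseteq> I" for n
    using from_nat_into[OF False] by (auto simp: J_def)
  define U where "U n = (\<Union>i\<in>J n. A i)" for n
  have meas_U: "U n \<in> sets M" for n
    unfolding U_def using J[of n] meas by (intro sets.finite_UN) auto
  have "(\<Union>n. J n) = from_nat_into I ` (\<Union>n. {..<n})"
    by (auto simp: J_def)
  also have "\<dots> = I"
    using False \<open>countable I\<close> by (simp add: UN_lessThan_UNIV range_from_nat_into)
  finally have "(\<Union>i\<in>I. A i) = (\<Union>n. U n)"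
    by (auto simp: U_def)
  moreover have "(SUP n. emeasure M (U n)) = emeasure M (\<Union>n. U n)"
  proof (rule SUP_emeasure_incseq)
    show "range U \<subseteq> sets M"
      using meas_U by blast
    show "incseq U"
      by (fastforce simp: incseq_def U_def J_def)
  qed
  moreover have "emeasure M (U n) \<le> C" for n
  proof -
    have "emeasure M (U n) \<le> (\<Sum>j\<in>J n. emeasure M (A j))"
      unfolding U_def using J[of n] meas by (intro emeasure_subadditive_finite) auto
    also have "\<dots> \<le> C"
      using J by (rule le)
    finally show ?thesis .
  qed
  ultimately show ?thesis
    by (metis SUP_least)
qed simp

text \<open>Bounded finite sums make the family summable, and a summable real family has countable
  support, which is all of \<open>I\<close> by positivity.\<close>

lemma countable_if_finite_sums_bounded:
  fixes g :: "'i \<Rightarrow> ennreal"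
  assumes pos: "\<And>i. i \<in> I \<Longrightarrow> g i > 0" and fin: "C < \<infinity>"
    and le: "\<And>J. finite J \<Longrightarrow> J \<subseteq> I \<Longrightarrow> sum g J \<le> C"
  shows "countable I"
proof -
  \<comment> \<open>Singleton sums show that all values are finite, so passing to reals by
    \<open>enn2real\<close> loses nothing.\<close>
  have lt: "g i < top" if "i \<in> I" for i
    using le[of "{i}"] that fin by (auto simp: le_less_trans)
  have "(\<lambda>i. enn2real (g i)) summable_on I"
  proof (rule nonneg_bdd_above_summable_on)
    show "bdd_above (sum (\<lambda>i. enn2real (g i)) ` {J. J \<subseteq> I \<and> finite J})"
    proof (rule bdd_aboveI2)
      fix J assume "J \<in> {J. J \<subseteq> I \<and> finite J}"
      then have J: "J \<subseteq> I" "finite J"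
        by auto
      have "(\<Sum>i\<in>J. enn2real (g i)) = enn2real (sum g J)"
        using lt J by (subst enn2real_sum) auto
      also have "\<dots> \<le> enn2real C"
        using fin le J by (intro enn2real_mono) auto
      finally show "(\<Sum>i\<in>J. enn2real (g i)) \<le> enn2real C" .
    qed
  qed simp
  then have "countable {i\<in>I. enn2real (g i) \<noteq> 0}"
    by (rule summable_countable_real)
  also have "{i\<in>I. enn2real (g i) \<noteq> 0} = I"
    using pos lt by (force simp: enn2real_eq_0_iff)
  finally show ?thesis .
qed

text \<open>The norm is defined through lists \<open>Q 0, ..., Q (n - 1)\<close>; enumerating
  \<open>J\<close> transfers it to families over an arbitrary finite index set.\<close>

lemma sum_le_set_function_norm:
  assumes "finite J" "disjoint_family_on B J" "\<And>j. j \<in> J \<Longrightarrow> B j \<in> \<A>"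
  shows "(\<Sum>j\<in>J. F (B j)) \<le> set_function_norm \<A> F"
proof -
  obtain h where h: "bij_betw h {..<card J} J"
    using ex_bij_betw_nat_finite[OF \<open>finite J\<close>] by (auto simp: atLeast0LessThan)
  have "disjoint_family_on (\<lambda>i. B (h i)) {..<card J}"
    using assms(2) h unfolding disjoint_family_on_def bij_betw_def inj_on_def by blast
  moreover have "\<forall>i<card J. B (h i) \<in> \<A>"
    using h assms(3) by (auto simp: bij_betw_def)
  moreover have "(\<Sum>j\<in>J. F (B j)) = (\<Sum>i<card J. F (B (h i)))"
    using sum.reindex_bij_betw[OF h, of "\<lambda>j. F (B j)"] by simp
  ultimately show ?thesis
    unfolding set_function_norm_def
    by (intro Sup_upper) (auto intro!: exI[of _ "card J"] exI[of _ "\<lambda>i. B (h i)"])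
qed

text \<open>Integrals over disjoint sets add up to the integral over their union. This derives the
  bound for functions from the one for set functions.\<close>

lemma set_function_norm_nn_integral_le:
  assumes f: "f \<in> borel_measurable M" and \<A>: "\<A> \<subseteq> sets M"
  shows "set_function_norm \<A> (\<lambda>Q. \<integral>\<^sup>+ y \<in> Q. f y \<partial>M) \<le> (\<integral>\<^sup>+ y. f y \<partial>M)"
  unfolding set_function_norm_def
proof (rule Sup_least, clarify)
  fix n :: nat and Q assume Q: "\<forall>i<n. Q i \<in> \<A>" "disjoint_family_on Q {..<n}"
  then have meas: "\<And>i. i < n \<Longrightarrow> Q i \<in> sets M"
    using \<A> by blast
  have "(\<Sum>i<n. \<integral>\<^sup>+ y \<in> Q i. f y \<partial>M) = (\<integral>\<^sup>+ y. (\<Sum>i<n. f y * indicator (Q i) y) \<partial>M)"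
    using f meas by (intro nn_integral_sum[symmetric]) (auto intro!: borel_measurable_times_ennreal)
  also have "\<dots> = (\<integral>\<^sup>+ y. f y * indicator (\<Union>i<n. Q i) y \<partial>M)"
    using Q(2) by (simp add: sum_distrib_left[symmetric] indicator_UN_disjoint)
  also have "\<dots> \<le> (\<integral>\<^sup>+ y. f y \<partial>M)"
    by (intro nn_integral_mono) (auto simp: indicator_def)
  finally show "(\<Sum>i<n. \<integral>\<^sup>+ y \<in> Q i. f y \<partial>M) \<le> (\<integral>\<^sup>+ y. f y \<partial>M)" .
qed

section \<open>Balls in a space of homogeneous type\<close>

context homogeneous_type
begin

lemma open_ball_in_sets: "x \<in> X \<Longrightarrow> r > 0 \<Longrightarrow> open_ball X d x r \<in> sets M"
  unfolding sets_eq_borel canonical_topology_def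
  by (intro sigma_sets.Basic CollectI) (auto intro!: topology_generated_by_Basis)

lemma center_in_open_ball: "x \<in> X \<Longrightarrow> r > 0 \<Longrightarrow> x \<in> open_ball X d x r"
  using dist_zero_iff[of x x] by (auto simp: open_ball_def)

lemma emeasure_dilated_ball_le:
  assumes "x \<in> X" "r > 0"
  shows "emeasure M (open_ball X d x (\<alpha> ^ n * r)) \<le> ennreal (\<beta> ^ n) * emeasure M (open_ball X d x r)"
proof (induction n)
  case (Suc n)
  have "emeasure M (open_ball X d x (\<alpha> * (\<alpha> ^ n * r)))
      \<le> ennreal \<beta> * emeasure M (open_ball X d x (\<alpha> ^ n * r))"
    using assms alpha_gt_1 by (intro doubling) auto
  also have "\<dots> \<le> ennreal \<beta> * (ennreal (\<beta> ^ n) * emeasure M (open_ball X d x r))"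
    using Suc.IH by (rule mult_left_mono) simp
  also have "\<dots> = ennreal (\<beta> ^ Suc n) * emeasure M (open_ball X d x r)"
    using beta_gt_1 by (simp add: ennreal_mult mult.assoc)
  finally show ?case
    by (simp add: mult.assoc)
qed simp

text \<open>Going through a common point \<open>w\<close>, two quasi-triangle inequalities give
  \<open>d y z < K * (s + K * (4 * s))\<close>, where \<open>4 * s\<close> bounds
  \<open>2 * r\<close>. Since \<open>K \<ge> 1\<close>, this is at most
  \<open>2 * K * (4 * K\<^sup>2 + 1) * s\<close>, the constant that determines
  \<open>m\<close>.\<close>

lemma open_ball_subset_of_meets:
  assumes x: "x \<in> X" and y: "y \<in> X" and r: "r \<le> 2 * s" and "s > 0"
    and meets: "open_ball X d x r \<inter> open_ball X d y s \<noteq> {}"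
    and t: "2 * K * (4 * K\<^sup>2 + 1) * s \<le> t"
  shows "open_ball X d x r \<subseteq> open_ball X d y t"
proof
  fix z assume "z \<in> open_ball X d x r"
  then have z: "z \<in> X" "d x z < r"
    by (auto simp: open_ball_def)
  obtain w where w: "w \<in> X" "d x w < r" "d y w < s"
    using meets by (auto simp: open_ball_def)
  have K0: "K > 0"
    using const_ge_1 by simp
  have "d w z \<le> K * (d w x + d x z)"
    using x w z by (intro quasi_triangle)
  also have "d w x = d x w"
    using x w by (intro dist_sym)
  also have "K * (d x w + d x z) \<le> K * (4 * s)"
    using w z r K0 by (intro mult_left_mono) auto
  finally have wz: "d w z \<le> K * (4 * s)" .
  have "d y z \<le> K * (d y w + d w z)"
    using y w z by (intro quasi_triangle)
  also have "\<dots> < K * (s + K * (4 * s))"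
    using w wz K0 by (intro mult_strict_left_mono) auto
  also have "\<dots> \<le> K * (2 * (4 * K\<^sup>2 + 1) * s)"
  proof (rule mult_left_mono)
    have "4 * K \<le> 4 * K\<^sup>2"
      using const_ge_1 by (simp add: power2_eq_square)
    then have "1 + 4 * K \<le> 2 * (4 * K\<^sup>2 + 1)"
      using const_ge_1 by simp
    then have "(1 + 4 * K) * s \<le> 2 * (4 * K\<^sup>2 + 1) * s"
      using \<open>s > 0\<close> by (intro mult_right_mono) auto
    then show "s + K * (4 * s) \<le> 2 * (4 * K\<^sup>2 + 1) * s"
      by (simp add: algebra_simps)
  qed (use K0 in simp)
  also have "\<dots> \<le> t"
    using t by (simp add: mult_ac)
  finally show "z \<in> open_ball X d y t"
    using z by (simp add: open_ball_def)
qed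

text \<open>This is all that the covering argument uses about the two families, so centred and
  containing balls are treated together.\<close>

lemma ball_family:
  assumes "\<Q> = centered_balls X d \<or> \<Q> = containing_balls X d" and "x \<in> X" and "Q \<in> \<Q> x"
  obtains y s where "y \<in> X" "s > 0" "Q = open_ball X d y s" "x \<in> open_ball X d y s"
  using assms center_in_open_ball unfolding centered_balls_def containing_balls_def by fastforce

section \<open>The weak-type estimate for set functions\<close>

lemma weak_type_bound:
  fixes F :: "'a set \<Rightarrow> ennreal" and r :: real
  assumes \<Q>: "\<Q> = centered_balls X d \<or> \<Q> = containing_balls X d"
    and m: "\<alpha> ^ m \<ge> 2 * K * (4 * K\<^sup>2 + 1)" and r: "r > 0"
  shows "outer_measure_of M {x \<in> X. set_maximal_function (outer_measure_of M) \<Q> F x > ennreal r}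
    \<le> ennreal (\<beta> ^ m * inverse r) * set_function_norm (\<Union>x\<in>X. \<Q> x) F"
    (is "outer_measure_of M ?E \<le> ennreal ?c * ?N")
proof -
  have c: "?c > 0"
    using r beta_gt_1 by simp
  \<comment> \<open>Balls are indexed by pairs of centre and radius, since a set may be a ball for
    several such pairs while its dilate depends on the pair.\<close>
  define B where "B = (\<lambda>(y, s). open_ball X d y s)"
  define D where "D = (\<lambda>(y, s). open_ball X d y (\<alpha> ^ m * s))"
  \<comment> \<open>The selection condition is stated without division; being strict, it also forces
    \<open>F\<close> to be positive on the chosen balls.\<close>
  define P where "P = {(y, s). y \<in> X \<and> s > 0 \<and> open_ball X d y s \<in> (\<Union>x\<in>X. \<Q> x) \<and>
    ennreal r * emeasure M (open_ball X d y s) < F (open_ball X d y s)}"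
  have P_in: "B p \<in> (\<Union>x\<in>X. \<Q> x)" if "p \<in> P" for p
    using that by (auto simp: B_def P_def)
  have D_le: "emeasure M (D p) \<le> ennreal ?c * F (B p)" if "p \<in> P" for p
  proof -
    obtain y s where p: "p = (y, s)" "y \<in> X" "s > 0"
      "ennreal r * emeasure M (open_ball X d y s) < F (open_ball X d y s)"
      using \<open>p \<in> P\<close> unfolding P_def by blast
    have "emeasure M (D p) \<le> ennreal (\<beta> ^ m) * emeasure M (open_ball X d y s)"
      using emeasure_dilated_ball_le p by (simp add: D_def)
    also have "\<dots> = ennreal ?c * (ennreal r * emeasure M (open_ball X d y s))"
    proof -
      have "ennreal ?c * ennreal r = ennreal (\<beta> ^ m)"
        using r beta_gt_1 by (subst ennreal_mult[symmetric]) auto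
      then show ?thesis
        by (simp only: mult.assoc[symmetric])
    qed
    also have "\<dots> \<le> ennreal ?c * F (B p)"
      using p by (intro mult_left_mono) (auto simp: B_def)
    finally show ?thesis .
  qed
  have D_sets: "D p \<in> sets M" if "p \<in> P" for p
    using that alpha_gt_1 by (auto simp: P_def D_def intro!: open_ball_in_sets)
  have sums_le: "(\<Sum>p\<in>J. F (B p)) \<le> ?N"
    if "finite J" "J \<subseteq> P" "disjoint_family_on B J" for J
    using that P_in by (intro sum_le_set_function_norm) auto
  have E_cover: "\<exists>p\<in>P. x \<in> B p" if "x \<in> ?E" for x
  proof -
    obtain Q where x: "x \<in> X" and Q: "Q \<in> \<Q> x" and less: "ennreal r < F Q / outer_measure_of M Q"
      using \<open>x \<in> ?E\<close> unfolding set_maximal_function_def less_SUP_iff by blast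
    obtain y s where ys: "y \<in> X" "s > 0" "Q = open_ball X d y s" "x \<in> open_ball X d y s"
      using ball_family[OF \<Q> x Q] .
    have out: "outer_measure_of M Q = emeasure M Q"
      using ys open_ball_in_sets by simp
    have "ennreal r * emeasure M Q < F Q"
    proof (rule ccontr)
      assume "\<not> ennreal r * emeasure M Q < F Q"
      then have "F Q / emeasure M Q \<le> ennreal r"
        using ball_pos ys by (intro divide_le_posI_ennreal) (auto simp: mult.commute not_less)
      with less out show False
        by simp
    qed
    with ys x Q have "(y, s) \<in> P" "x \<in> B (y, s)"
      by (auto simp: P_def B_def)
    then show ?thesis
      by blast
  qed
  show ?thesis
  \<comment> \<open>An empty \<open>X\<close> offers no centre \<open>x0\<close>, and an infinite
    norm makes the right-hand side infinite because \<open>?c > 0\<close>.\<close>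
  proof (cases "X = {} \<or> ?N = \<infinity>")
    case True
    then show ?thesis
    proof
      assume "X = {}"
      then have "?E = {}"
        by auto
      then show ?thesis
        by (simp only: outer_measure_of_eq sets.empty_sets emeasure_empty zero_le)
    next
      assume "?N = \<infinity>"
      then have "ennreal ?c * ?N = \<infinity>"
        using c by (simp only: ennreal_mult_eq_top_iff infinity_ennreal_def ennreal_eq_0_iff) simp
      then show ?thesis
        by simp
    qed
  next
    case False
    then obtain x0 where x0: "x0 \<in> X"
      by blast
    have N: "?N < \<infinity>"
      using False by (simp add: less_top)
    define P' where "P' n = {p\<in>P. B p \<inter> open_ball X d x0 (real n) \<noteq> {}}" for n :: nat
    have incseq_balls: "incseq (\<lambda>n. open_ball X d x0 (real n))"
      by (force simp: incseq_def open_ball_def)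
    have UN_balls: "(\<Union>n. open_ball X d x0 (real n)) = X"
      by (auto simp: open_ball_def reals_Archimedean2)
    show ?thesis
    proof (cases "\<forall>n. bdd_above (snd ` P' n)")
      case bounded: True
      have part: "outer_measure_of M (?E \<inter> open_ball X d x0 (real n)) \<le> ennreal ?c * ?N" for n
      proof -
        have "snd p > 0 \<and> B p \<noteq> {}" if "p \<in> P' n" for p
          using that by (auto simp: P'_def P_def)
        then obtain G where G: "G \<subseteq> P' n" "disjoint_family_on B G"
          and Vitali: "\<And>p. p \<in> P' n \<Longrightarrow> \<exists>q\<in>G. B p \<inter> B q \<noteq> {} \<and> snd p \<le> 2 * snd q"
          using bounded by (metis Vitali_disjoint_subfamily[of "P' n" snd B])
        have GP: "G \<subseteq> P"
          using G by (auto simp: P'_def)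
        have J_disj: "disjoint_family_on B J" if "J \<subseteq> G" for J
          using that G(2) by (rule disjoint_family_on_mono)
        \<comment> \<open>Disjointness bounds the finite sums of the positive values
          \<open>F (B p)\<close> by the finite norm.\<close>
        have "countable G"
        proof (rule countable_if_finite_sums_bounded[OF _ N])
          show "F (B p) > 0" if "p \<in> G" for p
          proof -
            have "p \<in> P"
              using that GP by blast
            then show ?thesis
              by (auto simp: P_def B_def intro: le_less_trans[OF zero_le])
          qed
          show "(\<Sum>p\<in>J. F (B p)) \<le> ?N" if "finite J" "J \<subseteq> G" for J
            using sums_le J_disj that GP by blast
        qed
        have cover: "?E \<inter> open_ball X d x0 (real n) \<subseteq> (\<Union>p\<in>G. D p)"
        proof
          fix x assume x: "x \<in> ?E \<inter> open_ball X d x0 (real n)"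
          then obtain p where p: "p \<in> P" "x \<in> B p"
            using E_cover by blast
          \<comment> \<open>The point \<open>x\<close> itself witnesses that \<open>B p\<close>
            meets the ball around \<open>x0\<close>.\<close>
          with x have "p \<in> P' n"
            by (auto simp: P'_def)
          then obtain q where q: "q \<in> G" "B p \<inter> B q \<noteq> {}" "snd p \<le> 2 * snd q"
            using Vitali by blast
          then have "q \<in> P"
            using GP by blast
          have "open_ball X d (fst p) (snd p) \<subseteq> open_ball X d (fst q) (\<alpha> ^ m * snd q)"
            using p(1) \<open>q \<in> P\<close> q m
            by (intro open_ball_subset_of_meets[where s = "snd q"] mult_right_mono)
              (auto simp: P_def B_def)
          then have "x \<in> D q"
            using p(2) by (auto simp: B_def D_def split_beta)
          with q(1) show "x \<in> (\<Union>p\<in>G. D p)"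
            by blast
        qed
        have UN_sets: "(\<Union>p\<in>G. D p) \<in> sets M"
          using GP D_sets \<open>countable G\<close> by (intro sets.countable_UN'') auto
        have "outer_measure_of M (?E \<inter> open_ball X d x0 (real n)) \<le> outer_measure_of M (\<Union>p\<in>G. D p)"
          using cover by (rule outer_measure_of_mono)
        also have "\<dots> = emeasure M (\<Union>p\<in>G. D p)"
          using UN_sets by simp
        also have "\<dots> \<le> ennreal ?c * ?N"
        proof (rule emeasure_countable_UN_le[OF \<open>countable G\<close>])
          show "D p \<in> sets M" if "p \<in> G" for p
            using that GP D_sets by blast
          fix J assume J: "finite J" "J \<subseteq> G"
          have "(\<Sum>p\<in>J. emeasure M (D p)) \<le> (\<Sum>p\<in>J. ennreal ?c * F (B p))"
            using D_le J GP by (intro sum_mono) blast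
          also have "\<dots> = ennreal ?c * (\<Sum>p\<in>J. F (B p))"
            by (rule sum_distrib_left[symmetric])
          also have "\<dots> \<le> ennreal ?c * ?N"
            using sums_le J J_disj GP by (intro mult_left_mono) auto
          finally show "(\<Sum>p\<in>J. emeasure M (D p)) \<le> ennreal ?c * ?N" .
        qed
        finally show ?thesis .
      qed
      have "(SUP n. outer_measure_of M (?E \<inter> open_ball X d x0 (real n)))
          = outer_measure_of M (\<Union>n. ?E \<inter> open_ball X d x0 (real n))"
      proof (rule SUP_outer_measure_of_incseq)
        show "incseq (\<lambda>n. ?E \<inter> open_ball X d x0 (real n))"
          using incseq_balls unfolding incseq_def by blast
      qed (auto simp: space_eq)
      also have "(\<Union>n. ?E \<inter> open_ball X d x0 (real n)) = ?E"
        using UN_balls by blast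
      finally show ?thesis
        using part by (metis (no_types, lifting) SUP_least)
    next
      case False
      then obtain n where n: "\<not> bdd_above (snd ` P' n)"
        by auto
      have part: "emeasure M (open_ball X d x0 (real j)) \<le> ennreal ?c * ?N" for j
      proof -
        \<comment> \<open>A radius above \<open>n\<close> puts a common point of \<open>B p\<close>
          and the \<open>n\<close>-th ball into the ball around \<open>x0\<close> of radius
          \<open>snd p\<close>; a radius above \<open>j\<close> makes that ball contain the
          \<open>j\<close>-th one. Two meeting balls of equal radius result.\<close>
        obtain p where p: "p \<in> P' n" "real (max j n) < snd p"
          using n by (meson bdd_aboveI2 not_le)
        then have "p \<in> P"
          by (simp add: P'_def)
        have meets: "open_ball X d x0 (snd p) \<inter> open_ball X d (fst p) (snd p) \<noteq> {}"
          using p by (force simp: P'_def B_def open_ball_def split_beta)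
        have "open_ball X d x0 (real j) \<subseteq> open_ball X d x0 (snd p)"
          using p by (auto simp: open_ball_def)
        also have "\<dots> \<subseteq> open_ball X d (fst p) (\<alpha> ^ m * snd p)"
          using \<open>p \<in> P\<close> x0 m meets
          by (intro open_ball_subset_of_meets[where s = "snd p"] mult_right_mono)
            (auto simp: P_def)
        also have "\<dots> = D p"
          by (simp add: D_def split_beta)
        finally have "emeasure M (open_ball X d x0 (real j)) \<le> emeasure M (D p)"
          using D_sets \<open>p \<in> P\<close> by (intro emeasure_mono)
        also have "\<dots> \<le> ennreal ?c * F (B p)"
          using D_le \<open>p \<in> P\<close> .
        \<comment> \<open>A single ball is already an admissible disjoint family for the
          norm.\<close>
        also have "\<dots> \<le> ennreal ?c * ?N"
          using sums_le[of "{p}"] \<open>p \<in> P\<close>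
          by (intro mult_left_mono) (auto simp: disjoint_family_on_def)
        finally show ?thesis .
      qed
      have "outer_measure_of M ?E \<le> outer_measure_of M X"
        by (rule outer_measure_of_mono) auto
      also have "\<dots> = emeasure M X"
        using space_eq by auto
      also have "\<dots> = (SUP j. emeasure M (open_ball X d x0 (real j)))"
      proof (subst SUP_emeasure_incseq[OF _ incseq_balls])
        have "open_ball X d x0 (real j) \<in> sets M" for j
        \<comment> \<open>The sequence starts with radius 0, where the ball is empty and
          \<open>open_ball_in_sets\<close> does not apply.\<close>
        proof (cases "j = 0")
          case True
          then have "open_ball X d x0 (real j) = {}"
            using x0 dist_nonneg by (force simp: open_ball_def)
          then show ?thesis
            by simp
        qed (use open_ball_in_sets x0 in simp)
        then show "range (\<lambda>j. open_ball X d x0 (real j)) \<subseteq> sets M"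
          by blast
      qed (simp add: UN_balls)
      also have "\<dots> \<le> ennreal ?c * ?N"
        using part by (rule SUP_least)
      finally show ?thesis .
    qed
  qed
qed

end

section \<open>The maximal constant and the bound for integrable functions\<close>

theorem theorem11:
  fixes X :: "'a set" and d :: "'a \<Rightarrow> 'a \<Rightarrow> real" and M :: "'a measure"
    and K \<alpha> \<beta> :: real and m :: nat and \<Q> :: "'a \<Rightarrow> 'a set set"
  assumes "homogeneous_type X d K M \<alpha> \<beta>"
    and "\<Q> = centered_balls X d \<or> \<Q> = containing_balls X d"
    and "m = (LEAST n. \<alpha> ^ n \<ge> 2 * K * (4 * K\<^sup>2 + 1))"
  shows "HL_maximal_constant X (outer_measure_of M) \<Q> \<le> ennreal (\<beta> ^ m) \<and>
    (\<forall>f :: 'a \<Rightarrow> complex. integrable M f \<longrightarrow>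
      (\<forall>r::real. r > 0 \<longrightarrow>
        outer_measure_of M {x \<in> X. maximal_function M \<Q> f x > ennreal r}
          \<le> ennreal (inverse r * \<beta> ^ m) * (\<integral>\<^sup>+ x. ennreal (norm (f x)) \<partial>M)))"
proof -
  interpret homogeneous_type X d K M \<alpha> \<beta>
    by fact
  have m: "\<alpha> ^ m \<ge> 2 * K * (4 * K\<^sup>2 + 1)"
    unfolding assms(3)
    \<comment> \<open>The powers of \<open>\<alpha> > 1\<close> are unbounded, so the least exponent
      exists.\<close>
    by (rule LeastI_ex) (meson alpha_gt_1 less_imp_le real_arch_pow)
  have "HL_maximal_constant X (outer_measure_of M) \<Q> \<le> ennreal (\<beta> ^ m)"
    unfolding HL_maximal_constant_def
    using weak_type_bound[OF assms(2) m] beta_gt_1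
    by (intro Inf_lower) (auto intro!: exI[of _ "\<beta> ^ m"])
  moreover have "outer_measure_of M {x \<in> X. maximal_function M \<Q> f x > ennreal r}
      \<le> ennreal (inverse r * \<beta> ^ m) * (\<integral>\<^sup>+ x. ennreal (norm (f x)) \<partial>M)"
    if f: "integrable M f" and r: "r > 0" for f :: "'a \<Rightarrow> complex" and r :: real
  proof -
    define F where "F = (\<lambda>Q. \<integral>\<^sup>+ y \<in> Q. ennreal (norm (f y)) \<partial>M)"
    have sets: "Q \<in> sets M" if "x \<in> X" "Q \<in> \<Q> x" for x Q
      using ball_family[OF assms(2) that] open_ball_in_sets by metis
    \<comment> \<open>Balls are measurable, so outer measure and measure agree in the
      denominators.\<close>
    have "maximal_function M \<Q> f x = set_maximal_function (outer_measure_of M) \<Q> F x"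
      if "x \<in> X" for x
      unfolding maximal_function_def set_maximal_function_def F_def
      using sets[OF that] by (intro SUP_cong) auto
    then have "{x \<in> X. maximal_function M \<Q> f x > ennreal r}
        = {x \<in> X. set_maximal_function (outer_measure_of M) \<Q> F x > ennreal r}"
      by auto
    also have "outer_measure_of M \<dots> \<le> ennreal (\<beta> ^ m * inverse r) * set_function_norm (\<Union>x\<in>X. \<Q> x) F"
      using assms(2) m r by (rule weak_type_bound)
    also have "\<dots> \<le> ennreal (\<beta> ^ m * inverse r) * (\<integral>\<^sup>+ x. ennreal (norm (f x)) \<partial>M)"
      unfolding F_def using f sets
      by (intro mult_left_mono set_function_norm_nn_integral_le) auto
    finally show ?thesis
      by (simp add: mult.commute)
  qed
  ultimately show ?thesis
    by blast
qed

end
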